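(* Let $A(t)$, $t\in\mathbb{R}$, be a continuous and bounded $n\times n$ matrix function, let $f:\mathbb{R}\times X\to X$ be continuous, and consider the nonlinear system $x'=A(t)x+f(t,x)$ and the linear system $x'=A(t)x$. Suppose that the linear system admits an exponential trichotomy with projections $P,Q$ and constants $\beta\ge 1$, $\alpha>0$, and that there are constants $\mu,\gamma\ge 0$ such that for all $t\in\mathbb{R}$ and $x,x_1,x_2\in X$ $$|f(t,x)|\le\mu,\qquad |f(t,x_1)-f(t,x_2)|\le\gamma|x_1-x_2|,\qquad 3\beta\gamma\alpha^{-1}<1.$$ Then the nonlinear system $x'=A(t)x+f(t,x)$ is topologically conjugated to its linear system $x'=A(t)x$.
   Context: $(X,|\cdot|)$ is a Banach space on which $n\times n$ matrices act, i.e. $X=\mathbb{R}^n$ with norm $|\cdot|$; matrices carry the induced operator norm. Exponential trichotomy: the linear system $x'=A(t)x$ with fundamental matrix $U(t)$ admits an exponential trichotomy if there exist projections $P,Q$ and constants $\beta\ge1$, $\alpha>0$ such that $PQ=QP$, $P+Q-PQ=I$, and - $|U(t)PU^{-1}(s)|\le\beta e^{-\alpha(t-s)}$ for $0\le s\le t$; - $|U(t)(I-P)U^{-1}(s)|\le\beta e^{-\alpha(s-t)}$ for $t\le s$, $s\ge0$; - $|U(t)QU^{-1}(s)|\le\beta e^{-\alpha(s-t)}$ for $t\le s\le0$; - $|U(t)(I-Q)U^{-1}(s)|\le\beta e^{-\alpha(t-s)}$ for $s\le t$, $s\le0$. Topological conjugacy: the system $x'=A(t)x+f(t,x)$ is topologically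 conjugated to $x'=A(t)x$ if there is a function $\mathscr H:\mathbb{R}\times X\to X$ (called an equivalent function) such that (i) for each fixed $t$, $\mathscr H(t,\cdot)$ is a homeomorphism of $X$ into $X$ (with inverse defined on $X$); (ii) $|\mathscr H(t,x)-x|$ is uniformly bounded with respect to $t$; (iii) $\mathscr L(t,\cdot)=\mathscr H^{-1}(t,\cdot)$ also has property (ii); (iv) if $x(t)$ is a solution of $x'=A(t)x+f(t,x)$, then $\mathscr H(t,x(t))$ is a solution of $x'=A(t)x$, and if $y(t)$ is a solution of $x'=A(t)x$, then $\mathscr L(t,y(t))$ is a solution of $x'=A(t)x+f(t,x)$. *)

theory Defs
  imports "HOL-Analysis.Analysis"
begin

text \<open>
  The phase space is \<open>real ^ 'n\<close> with an arbitrary norm \<open>N\<close>. Continuity,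
  derivatives and homeomorphisms refer to the standard topology of \<open>real ^ 'n\<close>, which is the
  topology induced by every such \<open>N\<close>; all quantitative bounds are stated in terms of \<open>N\<close>.
\<close>

definition is_norm :: "('a::real_vector \<Rightarrow> real) \<Rightarrow> bool" where
  "is_norm N \<longleftrightarrow>
     (\<forall>x. N x = 0 \<longleftrightarrow> x = 0) \<and>
     (\<forall>c x. N (c *\<^sub>R x) = \<bar>c\<bar> * N x) \<and>
     (\<forall>x y. N (x + y) \<le> N x + N y)"

text \<open>The operator norm induced by \<open>N\<close>, in the form of \<^const>\<open>onorm\<close>.\<close>

definition matrix_norm :: "(real ^ 'n \<Rightarrow> real) \<Rightarrow> real ^ 'n ^ 'n \<Rightarrow> real" where
  "matrix_norm N M = (SUP x. N (M *v x) / N x)"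

definition ode_solution :: "(real \<Rightarrow> real ^ 'n \<Rightarrow> real ^ 'n) \<Rightarrow> (real \<Rightarrow> real ^ 'n) \<Rightarrow> bool" where
  "ode_solution F x \<longleftrightarrow> (\<forall>t. (x has_vector_derivative F t (x t)) (at t))"

text \<open>No normalization \<open>U 0 = mat 1\<close> is imposed.\<close>

definition fundamental_matrix ::
    "(real \<Rightarrow> real ^ 'n ^ 'n) \<Rightarrow> (real \<Rightarrow> real ^ 'n ^ 'n) \<Rightarrow> bool" where
  "fundamental_matrix A U \<longleftrightarrow>
     (\<forall>t. (U has_vector_derivative A t ** U t) (at t)) \<and> (\<forall>t. invertible (U t))"

definition exponential_trichotomy ::
    "(real ^ 'n \<Rightarrow> real) \<Rightarrow> (real \<Rightarrow> real ^ 'n ^ 'n) \<Rightarrow> real ^ 'n ^ 'n \<Rightarrow> real ^ 'n ^ 'n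
      \<Rightarrow> real \<Rightarrow> real \<Rightarrow> bool" where
  "exponential_trichotomy N U P Q \<beta> \<alpha> \<longleftrightarrow>
     P ** P = P \<and> Q ** Q = Q \<and> \<beta> \<ge> 1 \<and> \<alpha> > 0 \<and>
     P ** Q = Q ** P \<and> P + Q - P ** Q = mat 1 \<and>
     (\<forall>t s. 0 \<le> s \<and> s \<le> t \<longrightarrow>
        matrix_norm N (U t ** P ** matrix_inv (U s)) \<le> \<beta> * exp (- \<alpha> * (t - s))) \<and>
     (\<forall>t s. t \<le> s \<and> s \<ge> 0 \<longrightarrow>
        matrix_norm N (U t ** (mat 1 - P) ** matrix_inv (U s)) \<le> \<beta> * exp (- \<alpha> * (s - t))) \<and>
     (\<forall>t s. t \<le> s \<and> s \<le> 0 \<longrightarrow>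
        matrix_norm N (U t ** Q ** matrix_inv (U s)) \<le> \<beta> * exp (- \<alpha> * (s - t))) \<and>
     (\<forall>t s. s \<le> t \<and> s \<le> 0 \<longrightarrow>
        matrix_norm N (U t ** (mat 1 - Q) ** matrix_inv (U s)) \<le> \<beta> * exp (- \<alpha> * (t - s)))"

text \<open>
  \<open>H\<close> is an equivalent function between \<open>x' = F(t,x)\<close> and \<open>x' = G(t,x)\<close>. The function \<open>L\<close> is
  uniquely determined by \<open>H\<close>: \<open>L t\<close> is the inverse of \<open>H t\<close>. The bounds on \<open>H t x - x\<close> and
  \<open>L t x - x\<close> are uniform in both \<open>t\<close> and \<open>x\<close>.
\<close>

definition equivalent_function ::
    "(real ^ 'n \<Rightarrow> real) \<Rightarrow> (real \<Rightarrow> real ^ 'n \<Rightarrow> real ^ 'n) \<Rightarrow> (real \<Rightarrow> real ^ 'n \<Rightarrow> real ^ 'n)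
      \<Rightarrow> (real \<Rightarrow> real ^ 'n \<Rightarrow> real ^ 'n) \<Rightarrow> bool" where
  "equivalent_function N F G H \<longleftrightarrow>
     (\<exists>L. (\<forall>t. homeomorphism UNIV UNIV (H t) (L t)) \<and>
          (\<exists>C. \<forall>t x. N (H t x - x) \<le> C) \<and>
          (\<exists>C. \<forall>t x. N (L t x - x) \<le> C) \<and>
          (\<forall>x. ode_solution F x \<longrightarrow> ode_solution G (\<lambda>t. H t (x t))) \<and>
          (\<forall>y. ode_solution G y \<longrightarrow> ode_solution F (\<lambda>t. L t (y t))))"

definition topologically_conjugated ::
    "(real ^ 'n \<Rightarrow> real) \<Rightarrow> (real \<Rightarrow> real ^ 'n \<Rightarrow> real ^ 'n) \<Rightarrow> (real \<Rightarrow> real ^ 'n \<Rightarrow> real ^ 'n) \<Rightarrow> bool"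
  where
  "topologically_conjugated N F G \<longleftrightarrow> (\<exists>H. equivalent_function N F G H)"

end

theory Submission
  imports Defs
begin

text \<open>
  Suppose that every bounded continuous forcing \<open>g\<close> can be turned into a bounded solution \<open>z\<close> of
  \<open>z' = A t *v z + g t\<close>, by a linear operator whose norm times \<open>\<gamma>\<close> is below 1. Then
  each linear solution \<open>y\<close> has a unique nearby solution \<open>x\<close> of the perturbed equation such that
  \<open>x - y\<close> is the distinguished bounded response to the forcing \<open>f s (x s)\<close>: the correction \<open>x - y\<close> is the fixed point of a contraction. Sending
  \<open>y t\<close> to \<open>x t\<close> defines the conjugacy \<open>L t\<close>, and \<open>H t\<close> is its inverse.

  Under a trichotomy the bounded response is in general not unique, because solutions of the linear equation
  with initial coordinates in the range of \<open>P ** Q\<close> decay in both directions. A fixed choice of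
  Green kernel selects one. The kernel used here splits a forcing at time \<open>s\<close> with \<open>P\<close> if \<open>s > 0\<close>
  and with \<open>I - Q\<close> if \<open>s \<le> 0\<close>, sends the selected part into the future and minus the rest into
  the past. The trichotomy estimates bound this kernel by \<open>\<beta> * exp (- \<alpha> * \<bar>t - s\<bar>)\<close> for all \<open>s\<close>
  and \<open>t\<close> (\<open>green_kernel_bound\<close>), so its operator norm is at most \<open>2 * \<beta> / \<alpha>\<close> (\<open>green_bound\<close>), and
  it solves the inhomogeneous equation (\<open>green_derivative\<close>).

  The corrections for all linear solutions are found at once, as a bounded continuous function of
  coordinates and time (\<open>bounded_correction_exists\<close>); this makes \<open>L t\<close> continuous. It is
  injective by uniqueness of solutions (\<open>ode_solution_unique\<close>): the distinguished response
  depends on the perturbed solution alone, so \<open>y\<close> can be recovered from \<open>x\<close>. It is surjective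
  because it has bounded distance from the identity (\<open>bounded_displacement_surj\<close>), which also
  yields a solution of the perturbed equation through every point without a separate existence
  theorem. Invariance of domain makes the inverse continuous.
\<close>

section \<open>Arbitrary norms on Euclidean spaces\<close>

lemma is_norm_zero: "is_norm N \<Longrightarrow> N 0 = 0"
  and is_norm_eq_zero: "is_norm N \<Longrightarrow> N x = 0 \<longleftrightarrow> x = 0"
  and is_norm_scale: "is_norm N \<Longrightarrow> N (c *\<^sub>R x) = \<bar>c\<bar> * N x"
  and is_norm_triangle: "is_norm N \<Longrightarrow> N (x + y) \<le> N x + N y"
  by (auto simp: is_norm_def)

lemma is_norm_minus: "is_norm N \<Longrightarrow> N (- x) = N x"
  using is_norm_scale[of N "-1" x] by simp

lemma is_norm_nonneg:
  assumes "is_norm N"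
  shows "N x \<ge> 0"
  using is_norm_triangle[OF assms, of x "- x"] by (simp add: is_norm_zero is_norm_minus assms)

lemma is_norm_pos: "is_norm N \<Longrightarrow> x \<noteq> 0 \<Longrightarrow> N x > 0"
  by (metis is_norm_eq_zero is_norm_nonneg less_eq_real_def)

text \<open>
  All norms on a Euclidean space are equivalent; the next two lemmas give the two inequalities.
  They are what lets estimates in \<open>N\<close> be combined with results about the standard norm
  (completeness, dominated convergence, Brouwer's theorem).
\<close>

lemma is_norm_le_norm:
  fixes N :: "'a::euclidean_space \<Rightarrow> real"
  assumes N: "is_norm N"
  obtains C where "C > 0" "\<And>x. N x \<le> C * norm x"
proof
  let ?C = "(\<Sum>b\<in>Basis. N b) + 1"
  have Ns: "N (sum g B) \<le> (\<Sum>b\<in>B. N (g b))" if "finite B" for g :: "'a \<Rightarrow> 'a" and B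
    using that
    by (induction B)
      (auto simp: is_norm_zero[OF N] intro: order_trans[OF is_norm_triangle[OF N]])
  have pos: "(\<Sum>b\<in>Basis. N b) \<ge> 0"
    by (intro sum_nonneg is_norm_nonneg[OF N])
  then show "?C > 0" by simp
  fix x
  have "N x = N (\<Sum>b\<in>Basis. (x \<bullet> b) *\<^sub>R b)"
    by (simp add: euclidean_representation)
  also have "\<dots> \<le> (\<Sum>b\<in>Basis. \<bar>x \<bullet> b\<bar> * N b)"
    using Ns[of Basis "\<lambda>b. (x \<bullet> b) *\<^sub>R b"] by (simp add: is_norm_scale[OF N])
  also have "\<dots> \<le> (\<Sum>b\<in>Basis. norm x * N b)"
    by (intro sum_mono mult_right_mono is_norm_nonneg[OF N] Basis_le_norm)
  also have "\<dots> \<le> ?C * norm x"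
    unfolding sum_distrib_left[symmetric] by (simp add: algebra_simps)
  finally show "N x \<le> ?C * norm x" .
qed

lemma norm_le_is_norm:
  fixes N :: "'a::euclidean_space \<Rightarrow> real"
  assumes N: "is_norm N"
  obtains c where "c > 0" "\<And>x. norm x \<le> c * N x"
proof -
  obtain C where C: "C > 0" "\<And>x. N x \<le> C * norm x"
    using is_norm_le_norm[OF N] by blast
  have diff: "\<bar>N x - N y\<bar> \<le> N (x - y)" for x y
    using is_norm_triangle[OF N, of "x - y" y] is_norm_triangle[OF N, of "y - x" x]
      is_norm_minus[OF N, of "x - y"] by simp
  have "C-lipschitz_on UNIV N"
    by (rule lipschitz_onI)
      (use C diff in \<open>auto simp: dist_norm intro: order_trans\<close>)
  then have "continuous_on UNIV N"
    by (rule lipschitz_on_continuous_on)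
  then have cont: "continuous_on (sphere 0 1) N"
    by (rule continuous_on_subset) simp
  have "sphere (0::'a) 1 \<noteq> {}"
    by simp
  then obtain z where z: "z \<in> sphere 0 1" "\<And>y. y \<in> sphere 0 1 \<Longrightarrow> N z \<le> N y"
    using continuous_attains_inf[OF compact_sphere _ cont] by blast
  have pos: "N z > 0"
    using z by (intro is_norm_pos[OF N]) auto
  show thesis
  proof
    show "1 / N z > 0" using pos by simp
    fix x :: 'a
    show "norm x \<le> 1 / N z * N x"
    proof (cases "x = 0")
      case False
      then have "N z \<le> N ((1 / norm x) *\<^sub>R x)"
        by (intro z) simp
      with False pos show ?thesis
        by (simp add: is_norm_scale[OF N] field_simps)
    qed (simp add: is_norm_zero[OF N])
  qed
qed

text \<open>
  The supremum defining \<^const>\<open>matrix_norm\<close> says nothing unless the set of quotients is bounded;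
  that it is bounded follows from the equivalence of \<open>N\<close> with the Euclidean norm.
\<close>

lemma matrix_norm_bound:
  fixes M :: "real ^ 'n ^ 'n"
  assumes N: "is_norm N"
  shows "N (M *v x) \<le> matrix_norm N M * N x"
proof (cases "x = 0")
  case False
  obtain C where C: "C > 0" "\<And>x. N x \<le> C * norm x"
    using is_norm_le_norm[OF N] by blast
  obtain c where c: "c > 0" "\<And>x. norm x \<le> c * N x"
    using norm_le_is_norm[OF N] by blast
  have "N (M *v y) / N y \<le> C * onorm ((*v) M) * c" for y
  proof (cases "y = 0")
    case False
    have "N (M *v y) \<le> C * norm (M *v y)"
      by (rule C)
    also have "\<dots> \<le> C * (onorm ((*v) M) * (c * N y))"
      using C(1) c
      by (intro mult_left_mono order_trans[OF onorm] mult_left_mono[OF c(2)] onorm_pos_le) auto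
    finally show ?thesis
      using is_norm_pos[OF N False] by (simp add: field_simps)
  qed (use C c in \<open>auto simp: is_norm_zero[OF N] intro!: mult_nonneg_nonneg onorm_pos_le\<close>)
  then have "bdd_above (range (\<lambda>y. N (M *v y) / N y))"
    by (auto simp: bdd_above_def)
  then have "N (M *v x) / N x \<le> matrix_norm N M"
    unfolding matrix_norm_def by (rule cSUP_upper[rotated]) simp
  then show ?thesis
    using is_norm_pos[OF N False] by (simp add: field_simps)
qed (simp add: is_norm_zero[OF N])

text \<open>
  The triangle inequality for integrals with respect to an arbitrary norm. Equivalence of norms
  would only give it up to a factor, which would spoil the contraction constant below. Write \<open>x\<close>
  for the integral of \<open>h\<close>. A hyperplane separating \<open>x\<close> from the open \<open>N\<close>-ball of radius \<open>N x\<close> yields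
  a vector \<open>a\<close> with \<open>N x * (a \<bullet> y) \<le> (a \<bullet> x) * N y\<close> for all \<open>y\<close>; integrating this scalar
  inequality along \<open>h\<close> gives the claim after division by \<open>a \<bullet> x\<close>.
\<close>

lemma is_norm_integral_le:
  fixes N :: "'a::euclidean_space \<Rightarrow> real"
  assumes N: "is_norm N" and h: "integrable M h" and k: "integrable M k"
    and le: "\<And>s. N (h s) \<le> k s"
  shows "N (integral\<^sup>L M h) \<le> integral\<^sup>L M k"
proof (cases "integral\<^sup>L M h = 0")
  case True
  have "integral\<^sup>L M k \<ge> 0"
    by (rule integral_nonneg_AE, rule AE_I2) (meson le is_norm_nonneg[OF N] order_trans)
  with True show ?thesis by (simp add: is_norm_zero[OF N])
next
  case False
  define x where "x = integral\<^sup>L M h"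
  have r: "N x > 0"
    using False by (auto simp: x_def intro: is_norm_pos[OF N])
  have "convex {y. N y < N x}"
  proof (rule convexI)
    fix y z and u v :: real
    assume *: "y \<in> {y. N y < N x}" "z \<in> {y. N y < N x}" "0 \<le> u" "0 \<le> v" "u + v = 1"
    have "N (u *\<^sub>R y + v *\<^sub>R z) \<le> u * N y + v * N z"
      using is_norm_triangle[OF N, of "u *\<^sub>R y" "v *\<^sub>R z"] * by (simp add: is_norm_scale[OF N])
    also have "\<dots> < N x"
      using * by (intro convex_bound_lt) auto
    finally show "u *\<^sub>R y + v *\<^sub>R z \<in> {y. N y < N x}" by simp
  qed
  moreover have "0 \<in> {y. N y < N x}"
    using r by (simp add: is_norm_zero[OF N])
  ultimately obtain a b where a: "a \<noteq> 0" and ab: "\<And>y. N y < N x \<Longrightarrow> a \<bullet> y \<le> b" "a \<bullet> x \<ge> b"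
    using separating_hyperplane_sets[of "{y. N y < N x}" "{x}"] by blast
  \<comment> \<open>Scale \<open>y\<close> into the ball with a factor \<open>z < 1\<close>, and let \<open>z\<close> tend to 1.\<close>
  have supp: "N x * (a \<bullet> y) \<le> (a \<bullet> x) * N y" for y
  proof (cases "y = 0")
    case False
    then have y: "N y > 0" by (rule is_norm_pos[OF N])
    show ?thesis
    proof (rule field_le_mult_one_interval)
      fix z :: real assume z: "0 < z" "z < 1"
      have "a \<bullet> ((z * N x / N y) *\<^sub>R y) \<le> a \<bullet> x"
        using z y r by (intro order_trans[OF ab]) (auto simp: is_norm_scale[OF N])
      then show "z * (N x * (a \<bullet> y)) \<le> (a \<bullet> x) * N y"
        using y by (simp add: field_simps)
    qed
  qed (simp add: is_norm_zero[OF N])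
  have ax: "a \<bullet> x > 0"
  proof -
    have "0 < N x * (a \<bullet> a)"
      using r a by simp
    also have "\<dots> \<le> (a \<bullet> x) * N a"
      by (rule supp)
    finally show ?thesis
      using is_norm_pos[OF N a] by (simp add: zero_less_mult_iff)
  qed
  have "N x * (a \<bullet> x) = (\<integral>s. N x * (a \<bullet> h s) \<partial>M)"
    using h by (simp add: x_def)
  also have "\<dots> \<le> (\<integral>s. (a \<bullet> x) * k s \<partial>M)"
  proof (rule integral_mono)
    fix s
    show "N x * (a \<bullet> h s) \<le> (a \<bullet> x) * k s"
      using supp[of "h s"] mult_left_mono[OF le[of s], of "a \<bullet> x"] ax by linarith
  qed (use h k in auto)
  also have "\<dots> = (a \<bullet> x) * integral\<^sup>L M k"
    by simp
  finally show ?thesis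
    using ax by (simp add: x_def mult.commute)
qed

section \<open>Fixed points, surjectivity and uniqueness of solutions\<close>

text \<open>
  A map that contracts by \<open>q\<close> in some norm satisfies, in an equivalent norm, this estimate with
  a constant \<open>c\<close> in front. Some iterate is then an honest contraction, and its unique fixed
  point is fixed by \<open>T\<close> too, because \<open>T\<close> maps fixed points of the iterate to fixed points.
\<close>

lemma banach_fix_iterate:
  fixes T :: "'a::complete_space \<Rightarrow> 'a"
  assumes q: "0 \<le> q" "q < 1"
    and lip: "\<And>k x y. dist ((T ^^ k) x) ((T ^^ k) y) \<le> c * q ^ k * dist x y"
  shows "\<exists>x. T x = x"
proof -
  have "(\<lambda>k. c * q ^ k) \<longlonglongrightarrow> c * 0"
    using q by (intro tendsto_mult tendsto_const LIMSEQ_power_zero) auto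
  then have "eventually (\<lambda>k. c * q ^ k < 1) sequentially"
    by (intro order_tendstoD(2)) auto
  then obtain k where "c * q ^ k < 1"
    by (auto simp: eventually_sequentially)
  then have "\<exists>!x. (T ^^ k) x = x"
    using order_trans[OF lip[of k] mult_right_mono[OF max.cobounded2[of "c * q ^ k" 0]]]
    by (intro banach_fix_type[of "max 0 (c * q ^ k)"]) auto
  then obtain x where x: "(T ^^ k) x = x" "\<And>y. (T ^^ k) y = y \<Longrightarrow> y = x"
    by auto
  have "(T ^^ k) (T x) = T x"
    using x(1) by (metis funpow_swap1)
  then show ?thesis
    using x(2) by blast
qed

text \<open>
  By Brouwer's theorem: solving \<open>h x = y\<close> means finding a fixed point of
  \<open>x \<mapsto> y - (h x - x)\<close>, and this map sends a large enough ball around \<open>y\<close> into itself.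
\<close>

lemma bounded_displacement_surj:
  fixes h :: "'a::euclidean_space \<Rightarrow> 'a"
  assumes cont: "continuous_on UNIV h" and bound: "\<And>x. norm (h x - x) \<le> C"
  shows "surj h"
proof (rule surjI)
  have "\<exists>x. h x = y" for y
  proof -
    have C: "C \<ge> 0"
      using bound norm_ge_zero order_trans by blast
    obtain x where "y - (h x - x) = x"
    proof (rule brouwer_ball[of "C + 1" y "\<lambda>x. y - (h x - x)"])
      show "continuous_on (cball y (C + 1)) (\<lambda>x. y - (h x - x))"
        by (intro continuous_intros continuous_on_subset[OF cont]) auto
      show "(\<lambda>x. y - (h x - x)) \<in> cball y (C + 1) \<rightarrow> cball y (C + 1)"
        by (auto simp: dist_norm intro!: order_trans[OF bound])
    qed (use C in auto)
    then have "h x = y" by (simp add: algebra_simps)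
    then show ?thesis ..
  qed
  then show "h (SOME x. h x = y) = y" for y
    by (rule someI_ex)
qed

text \<open>
  Gronwall's argument, in both directions of time. The squared distance \<open>\<phi>\<close> of two solutions
  satisfies \<open>\<bar>\<phi>'\<bar> \<le> 2 * K * \<phi>\<close>, so \<open>\<phi> t * exp (- 2 * K * t)\<close> is nonincreasing and
  \<open>\<phi> t * exp (2 * K * t)\<close> is nondecreasing; hence a zero of \<open>\<phi>\<close> spreads to all times.
\<close>

lemma ode_solution_unique:
  fixes F :: "real \<Rightarrow> real ^ 'n \<Rightarrow> real ^ 'n"
  assumes lip: "\<And>t x y. norm (F t x - F t y) \<le> K * norm (x - y)"
    and x: "ode_solution F x" and y: "ode_solution F y" and eq: "x t0 = y t0"
  shows "x = y"
proof
  fix t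
  define d where "d = (\<lambda>t. x t - y t)"
  define \<phi> where "\<phi> = (\<lambda>t. d t \<bullet> d t)"
  define \<phi>' where "\<phi>' = (\<lambda>t. 2 * (d t \<bullet> (F t (x t) - F t (y t))))"
  have d: "(d has_vector_derivative F t (x t) - F t (y t)) (at t)" for t
    using x y unfolding d_def ode_solution_def by (intro derivative_intros) auto
  have der: "(\<phi> has_real_derivative \<phi>' t) (at t)" for t
    using bounded_bilinear.has_vector_derivative[OF bounded_bilinear_inner d d]
    unfolding \<phi>_def \<phi>'_def has_real_derivative_iff_has_vector_derivative
    by (simp add: inner_commute)
  have \<phi>'_le: "\<bar>\<phi>' t\<bar> \<le> 2 * K * \<phi> t" for t
  proof -
    have "\<bar>d t \<bullet> (F t (x t) - F t (y t))\<bar> \<le> norm (d t) * (K * norm (d t))"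
      using lip[of t "x t" "y t"] unfolding d_def[symmetric]
      by (intro order_trans[OF Cauchy_Schwarz_ineq2] mult_left_mono) (auto simp: d_def)
    then show ?thesis
      by (simp add: \<phi>_def \<phi>'_def abs_mult power2_norm_eq_inner[symmetric] power2_eq_square
          ac_simps)
  qed
  have \<phi>0: "\<phi> t0 = 0" by (simp add: \<phi>_def d_def eq)
  have "\<phi> t \<le> 0"
  proof (cases "t0 \<le> t")
    case True
    have "\<phi> t * exp (- 2 * K * t) \<le> \<phi> t0 * exp (- 2 * K * t0)"
    proof (rule DERIV_nonpos_imp_nonincreasing[OF True], intro exI conjI)
      fix r
      show "((\<lambda>r. \<phi> r * exp (- 2 * K * r)) has_real_derivative
          (\<phi>' r - 2 * K * \<phi> r) * exp (- 2 * K * r)) (at r)"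
        by (auto intro!: derivative_eq_intros der simp: algebra_simps)
      show "(\<phi>' r - 2 * K * \<phi> r) * exp (- 2 * K * r) \<le> 0"
        using \<phi>'_le[of r] by (simp add: mult_le_0_iff)
    qed
    then show ?thesis by (simp add: \<phi>0 mult_le_0_iff)
  next
    case False
    then have "t \<le> t0" by simp
    have "\<phi> t * exp (2 * K * t) \<le> \<phi> t0 * exp (2 * K * t0)"
    proof (rule DERIV_nonneg_imp_nondecreasing[OF \<open>t \<le> t0\<close>], intro exI conjI)
      fix r
      show "((\<lambda>r. \<phi> r * exp (2 * K * r)) has_real_derivative
          (\<phi>' r + 2 * K * \<phi> r) * exp (2 * K * r)) (at r)"
        by (auto intro!: derivative_eq_intros der simp: algebra_simps)
      show "(\<phi>' r + 2 * K * \<phi> r) * exp (2 * K * r) \<ge> 0"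
        using \<phi>'_le[of r] by simp
    qed
    then show ?thesis by (simp add: \<phi>0 mult_le_0_iff)
  qed
  then have "d t = 0"
    by (metis \<phi>_def inner_eq_zero_iff inner_ge_zero order_antisym)
  then show "x t = y t" by (simp add: d_def)
qed

section \<open>Matrices depending on a parameter\<close>

lemma bounded_bilinear_matrix_vector_mult:
  "bounded_bilinear ((*v) :: real ^ 'n ^ 'm \<Rightarrow> real ^ 'n \<Rightarrow> real ^ 'm)"
  unfolding bilinear_conv_bounded_bilinear[symmetric] bilinear_def
  by (auto intro!: linearI simp: matrix_vector_mult_add_rdistrib matrix_vector_right_distrib
      matrix_vector_mult_scaleR scaleR_matrix_vector_assoc)

lemmas continuous_on_matrix_vector_mult [continuous_intros] =
  bounded_bilinear.continuous_on[OF bounded_bilinear_matrix_vector_mult]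

lemma matrix_inv_cancel:
  fixes M :: "real ^ 'n ^ 'n"
  assumes "invertible M"
  shows "M ** matrix_inv M = mat 1" "matrix_inv M ** M = mat 1"
  using assms unfolding invertible_def matrix_inv_def by (metis (mono_tags, lifting) someI_ex)+

lemma matrix_inv_cancel_vec:
  fixes M :: "real ^ 'n ^ 'n"
  assumes "invertible M"
  shows "M *v (matrix_inv M *v x) = x" "matrix_inv M *v (M *v x) = x"
  using matrix_inv_cancel[OF assms] by (simp_all add: matrix_vector_mul_assoc)

lemma continuous_on_det [continuous_intros]:
  fixes M :: "'a::topological_space \<Rightarrow> real ^ 'n ^ 'n"
  assumes "continuous_on S M"
  shows "continuous_on S (\<lambda>s. det (M s))"
  unfolding det_def by (intro continuous_intros assms)

text \<open>
  By Cramer's rule, the components of the inverse applied to a vector are quotients of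
  determinants.
\<close>

lemma continuous_on_matrix_inv_mult:
  fixes U :: "'a::topological_space \<Rightarrow> real ^ 'n ^ 'n" and g :: "'a \<Rightarrow> real ^ 'n"
  assumes U: "continuous_on S U" and g: "continuous_on S g"
    and inv: "\<And>s. s \<in> S \<Longrightarrow> invertible (U s)"
  shows "continuous_on S (\<lambda>s. matrix_inv (U s) *v g s)"
proof -
  have nz: "det (U s) \<noteq> 0" if "s \<in> S" for s
    using inv[OF that] by (simp add: invertible_det_nz)
  have entry: "continuous_on S (\<lambda>s. if j = k then g s $ i else U s $ i $ j)" for i j k :: 'n
    by (cases "j = k") (auto intro!: continuous_intros U g)
  have "continuous_on S (\<lambda>s. \<chi> k. det (\<chi> i j. if j = k then g s $ i else U s $ i $ j) / det (U s))"
    by (intro continuous_intros U entry) (use nz in auto)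
  moreover have "matrix_inv (U s) *v g s =
      (\<chi> k. det (\<chi> i j. if j = k then g s $ i else U s $ i $ j) / det (U s))" if "s \<in> S" for s
    using cramer[OF nz[OF that], of "matrix_inv (U s) *v g s" "g s"]
    by (simp add: matrix_inv_cancel_vec inv that)
  ultimately show ?thesis
    by (simp cong: continuous_on_cong)
qed

section \<open>The Green operator of an exponential trichotomy\<close>

lemma has_bochner_integral_exp_abs:
  fixes \<alpha> t :: real
  assumes \<alpha>: "\<alpha> > 0"
  shows "has_bochner_integral lborel (\<lambda>s. exp (- \<alpha> * \<bar>t - s\<bar>)) (2 / \<alpha>)"
proof -
  \<comment> \<open>The integrand is the sum of a translate of the one-sided exponential \<open>k\<close> and a
    reflected translate of it, except at the single point \<open>s = t\<close>, where both summands are 1.\<close>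
  define k where "k = (\<lambda>s::real. if s \<in> {0..} then exp (- \<alpha> * s) else 0)"
  have meas [measurable]: "k \<in> borel_measurable borel"
    unfolding k_def by measurable
  have "(k has_integral 1 / \<alpha>) UNIV"
    unfolding k_def has_integral_restrict_UNIV
    using has_integral_exp_minus_to_infinity[OF \<alpha>, of 0] by simp
  then have "integral\<^sup>N lborel k = 1 / \<alpha>"
    by (intro nn_integral_has_integral_lborel meas) (auto simp: k_def)
  then have k: "has_bochner_integral lborel k (1 / \<alpha>)"
    using \<alpha> by (intro has_bochner_integral_nn_integral) (auto simp: k_def)
  have "has_bochner_integral lborel (\<lambda>s. k (- t + 1 * s) + k (t + (- 1) * s)) (1 / \<alpha> + 1 / \<alpha>)"
    using k lborel_has_bochner_integral_real_affine_iff[of 1 k "1 / \<alpha>" "- t"]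
      lborel_has_bochner_integral_real_affine_iff[of "- 1" k "1 / \<alpha>" t]
    by (intro has_bochner_integral_add) auto
  moreover have "AE s in lborel. k (- t + 1 * s) + k (t + (- 1) * s) = exp (- \<alpha> * \<bar>t - s\<bar>)"
    using AE_lborel_singleton[of t]
    by eventually_elim (auto simp: k_def abs_if)
  ultimately show ?thesis
    by (subst has_bochner_integral_cong_AE[symmetric]) (auto simp: k_def)
qed

locale trichotomy =
  fixes N :: "real ^ 'n \<Rightarrow> real" and A U :: "real \<Rightarrow> real ^ 'n ^ 'n" and P Q :: "real ^ 'n ^ 'n"
    and \<alpha> \<beta> :: real
  assumes norm_N: "is_norm N"
    and fundamental: "fundamental_matrix A U"
    and trichotomic: "exponential_trichotomy N U P Q \<beta> \<alpha>"
begin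

lemma U_derivative: "(U has_vector_derivative A t ** U t) (at t)"
  and U_invertible: "invertible (U t)"
  using fundamental by (auto simp: fundamental_matrix_def)

lemma \<alpha>_pos: "\<alpha> > 0" and \<beta>_ge_1: "\<beta> \<ge> 1"
  using trichotomic unfolding exponential_trichotomy_def by blast+

lemma continuous_on_U: "continuous_on S U"
  using U_derivative
  by (meson continuous_at_imp_continuous_on has_vector_derivative_continuous)

lemma U_mult_derivative:
  assumes "(c has_vector_derivative c') (at t)"
  shows "((\<lambda>t. U t *v c t) has_vector_derivative A t *v (U t *v c t) + U t *v c') (at t)"
  using bounded_bilinear.has_vector_derivative[OF bounded_bilinear_matrix_vector_mult
      U_derivative assms]
  by (simp add: matrix_vector_mul_assoc add.commute)

definition forward_projection :: "real \<Rightarrow> real ^ 'n ^ 'n" where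
  "forward_projection s = (if s \<le> 0 then mat 1 - Q else P)"

text \<open>
  The effect at time \<open>t\<close> of a forcing \<open>w\<close> acting at time \<open>s\<close>. In the coordinates given by the
  fundamental matrix, the part of \<open>w\<close> selected by the projection at \<open>s\<close> is propagated into the
  future (\<open>s \<le> t\<close>), and minus the complementary part is propagated into the past (\<open>t < s\<close>). The
  projection depends on the sign of \<open>s\<close> only: it is \<open>I - Q\<close> for \<open>s \<le> 0\<close> and \<open>P\<close> for \<open>s > 0\<close>.
  Each of the four resulting combinations is controlled by an exponential trichotomy for all \<open>t\<close>
  on the relevant side of \<open>s\<close>, across 0 as well. The kernel is written as a difference so that
  its dependence on \<open>t\<close> before applying \<open>U t\<close> reduces to a jump by the identity at \<open>t = s\<close>.
\<close>

definition green_coordinates :: "real \<Rightarrow> real \<Rightarrow> real ^ 'n \<Rightarrow> real ^ 'n" where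
  "green_coordinates t s w =
     forward_projection s *v (matrix_inv (U s) *v w) - (if t < s then matrix_inv (U s) *v w else 0)"

definition green_kernel :: "real \<Rightarrow> real \<Rightarrow> real ^ 'n \<Rightarrow> real ^ 'n" where
  "green_kernel t s w = U t *v green_coordinates t s w"

definition green :: "(real \<Rightarrow> real ^ 'n) \<Rightarrow> real \<Rightarrow> real ^ 'n" where
  "green g t = (\<integral>s. green_kernel t s (g s) \<partial>lborel)"

lemma green_kernel_diff: "green_kernel t s (w - w') = green_kernel t s w - green_kernel t s w'"
  by (simp add: green_kernel_def green_coordinates_def matrix_vector_mult_diff_distrib)

text \<open>
  One two-sided exponential estimate replaces the four estimates of the trichotomy: each of the
  four combinations of the order of \<open>s\<close> and \<open>t\<close> and the sign of \<open>s\<close> uses exactly one of them.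
\<close>

lemma green_kernel_bound: "N (green_kernel t s w) \<le> \<beta> * exp (- \<alpha> * \<bar>t - s\<bar>) * N w"
proof -
  have key: "N (green_kernel t s w) \<le> \<beta> * exp (- \<alpha> * \<bar>t - s\<bar>) * N w"
    if "matrix_norm N (U t ** M ** matrix_inv (U s)) \<le> \<beta> * exp (- \<alpha> * \<bar>t - s\<bar>)"
      and "green_coordinates t s w = M *v (matrix_inv (U s) *v w) \<or>
           green_coordinates t s w = - (M *v (matrix_inv (U s) *v w))" for M
  proof -
    define v where "v = (U t ** M ** matrix_inv (U s)) *v w"
    have "green_kernel t s w = v \<or> green_kernel t s w = - v"
      using that(2) linear_neg[OF matrix_vector_mul_linear[of "U t"]]
      by (auto simp: green_kernel_def v_def matrix_vector_mul_assoc[symmetric])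
    then have "N (green_kernel t s w) = N v"
      by (auto simp: is_norm_minus[OF norm_N])
    also have "\<dots> \<le> matrix_norm N (U t ** M ** matrix_inv (U s)) * N w"
      unfolding v_def by (rule matrix_norm_bound[OF norm_N])
    also have "\<dots> \<le> \<beta> * exp (- \<alpha> * \<bar>t - s\<bar>) * N w"
      by (intro mult_right_mono that(1) is_norm_nonneg[OF norm_N])
    finally show ?thesis .
  qed
  note tri = trichotomic[unfolded exponential_trichotomy_def]
  consider "s \<le> t" "s \<le> 0" | "s \<le> t" "0 < s" | "t < s" "s \<le> 0" | "t < s" "0 < s"
    by linarith
  then show ?thesis
  proof cases
    case 1
    with tri show ?thesis
      by (intro key[of "mat 1 - Q"]) (auto simp: green_coordinates_def forward_projection_def)
  next
    case 2
    with tri show ?thesis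
      by (intro key[of P]) (auto simp: green_coordinates_def forward_projection_def)
  next
    case 3
    with tri show ?thesis
      by (intro key[of Q])
        (auto simp: green_coordinates_def forward_projection_def matrix_vector_mult_diff_rdistrib)
  next
    case 4
    with tri show ?thesis
      by (intro key[of "mat 1 - P"])
        (auto simp: green_coordinates_def forward_projection_def matrix_vector_mult_diff_rdistrib)
  qed
qed

lemma measurable_green_coordinates:
  assumes "continuous_on UNIV g"
  shows "(\<lambda>s. green_coordinates t s (g s)) \<in> borel_measurable lborel"
proof -
  define h where "h = (\<lambda>s. matrix_inv (U s) *v g s)"
  have h: "continuous_on UNIV h"
    unfolding h_def
    by (intro continuous_on_matrix_inv_mult continuous_on_U assms U_invertible)
  have [measurable]: "h \<in> borel_measurable borel" "(\<lambda>s. M *v h s) \<in> borel_measurable borel" for M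
    by (intro borel_measurable_continuous_onI continuous_intros h)+
  have "green_coordinates t s (g s) =
      (if s \<le> 0 then (mat 1 - Q) *v h s else P *v h s) - (if t < s then h s else 0)" for s
    by (simp add: green_coordinates_def forward_projection_def h_def)
  then show ?thesis by simp
qed

lemma measurable_green_kernel:
  assumes "continuous_on UNIV g"
  shows "(\<lambda>s. green_kernel t s (g s)) \<in> borel_measurable lborel"
  unfolding green_kernel_def
  by (intro borel_measurable_continuous_on[OF _ measurable_green_coordinates[OF assms]]
      continuous_intros)

lemma integrable_green_kernel:
  assumes g: "continuous_on UNIV g" and bound: "\<And>s. N (g s) \<le> m"
  shows "integrable lborel (\<lambda>s. green_kernel t s (g s))"
proof -
  obtain c where c: "c > 0" "\<And>x :: real ^ 'n. norm x \<le> c * N x"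
    using norm_le_is_norm[OF norm_N] by blast
  show ?thesis
  proof (rule Bochner_Integration.integrable_bound)
    show "integrable lborel (\<lambda>s. c * (\<beta> * exp (- \<alpha> * \<bar>t - s\<bar>) * m))"
      using has_bochner_integral_exp_abs[OF \<alpha>_pos, of t] by (auto dest: integrable.intros)
    have "norm (green_kernel t s (g s)) \<le> c * (\<beta> * exp (- \<alpha> * \<bar>t - s\<bar>) * m)" for s
      using c \<beta>_ge_1
      by (intro order_trans[OF c(2)] mult_left_mono order_trans[OF green_kernel_bound] bound) auto
    then show "AE s in lborel. norm (green_kernel t s (g s))
        \<le> norm (c * (\<beta> * exp (- \<alpha> * \<bar>t - s\<bar>) * m))"
      by (auto intro!: AE_I2 order_trans[OF _ abs_ge_self])
  qed (rule measurable_green_kernel[OF g])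
qed

text \<open>
  The trichotomy bounds the full kernel only, so integrability is inherited from there, by
  applying the inverse of \<open>U t\<close> for the fixed \<open>t\<close>.
\<close>

lemma integrable_green_coordinates:
  assumes "continuous_on UNIV g" and "\<And>s. N (g s) \<le> m"
  shows "integrable lborel (\<lambda>s. green_coordinates t s (g s))"
proof -
  have "integrable lborel (\<lambda>s. matrix_inv (U t) *v green_kernel t s (g s))"
    by (intro integrable_bounded_linear[OF matrix_vector_mul_bounded_linear]
        integrable_green_kernel[OF assms])
  then show ?thesis
    by (simp add: green_kernel_def matrix_inv_cancel_vec U_invertible)
qed

text \<open>
  The factor \<open>2 * \<beta> / \<alpha>\<close> is the integral of \<open>\<beta> * exp (- \<alpha> * \<bar>t - s\<bar>)\<close> over \<open>s\<close>.
\<close>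

lemma green_bound:
  assumes g: "continuous_on UNIV g" and bound: "\<And>s. N (g s) \<le> m"
  shows "N (green g t) \<le> 2 * \<beta> / \<alpha> * m"
proof -
  have k: "has_bochner_integral lborel (\<lambda>s. \<beta> * exp (- \<alpha> * \<bar>t - s\<bar>) * m) (\<beta> * (2 / \<alpha>) * m)"
    by (intro has_bochner_integral_mult_left has_bochner_integral_mult_right
        has_bochner_integral_exp_abs \<alpha>_pos)
  have "N (green g t) \<le> (\<integral>s. \<beta> * exp (- \<alpha> * \<bar>t - s\<bar>) * m \<partial>lborel)"
    unfolding green_def
  proof (rule is_norm_integral_le[OF norm_N integrable_green_kernel[OF assms]])
    show "N (green_kernel t s (g s)) \<le> \<beta> * exp (- \<alpha> * \<bar>t - s\<bar>) * m" for s
      using \<beta>_ge_1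
      by (intro order_trans[OF green_kernel_bound] mult_left_mono bound) auto
  qed (use k in \<open>auto dest: integrable.intros\<close>)
  also have "\<dots> = 2 * \<beta> / \<alpha> * m"
    using has_bochner_integral_integral_eq[OF k] by simp
  finally show ?thesis .
qed

lemma green_diff:
  assumes "continuous_on UNIV g" "\<And>s. N (g s) \<le> m"
    and "continuous_on UNIV g'" "\<And>s. N (g' s) \<le> m'"
  shows "green g t - green g' t = green (\<lambda>s. g s - g' s) t"
  unfolding green_def green_kernel_diff
  by (intro Bochner_Integration.integral_diff[symmetric]
      integrable_green_kernel[OF assms(1,2)] integrable_green_kernel[OF assms(3,4)])

text \<open>
  In the coordinates given by \<open>U\<close> the function is \<open>c\<close>, and the jump of the kernel makes
  \<open>c r - c t0\<close> the integral of \<open>h\<close> from \<open>t0\<close> to \<open>r\<close>, which the fundamental theorem of calculus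
  differentiates.
\<close>

lemma green_derivative:
  assumes g: "continuous_on UNIV g" and bound: "\<And>s. N (g s) \<le> m"
  shows "(green g has_vector_derivative A t *v green g t + g t) (at t)"
proof -
  define h where "h = (\<lambda>s. matrix_inv (U s) *v g s)"
  define c where "c = (\<lambda>t. \<integral>s. green_coordinates t s (g s) \<partial>lborel)"
  note int = integrable_green_coordinates[OF g bound]
  have h: "continuous_on S h" for S
    unfolding h_def
    by (intro continuous_on_matrix_inv_mult continuous_on_U continuous_on_subset[OF g] U_invertible)
      simp
  have green: "green g = (\<lambda>t. U t *v c t)"
    by (simp add: fun_eq_iff green_def green_kernel_def c_def
        integral_bounded_linear[OF matrix_vector_mul_bounded_linear int])
  \<comment> \<open>Any base point strictly to the left of \<open>t\<close> will do: \<open>t\<close> then is an interior point.\<close>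
  define t0 where "t0 = t - 1"
  have c_eq: "c r = c t0 + (LBINT s=t0..r. h s)" if "t0 \<le> r" for r
  proof -
    have "green_coordinates r s (g s) - green_coordinates t0 s (g s) =
        indicator {t0<..r} s *\<^sub>R h s" for s
      using that by (auto simp: green_coordinates_def h_def indicator_def)
    then have "c r - c t0 = (LBINT s:{t0<..r}. h s)"
      unfolding c_def set_lebesgue_integral_def
      by (subst Bochner_Integration.integral_diff[OF int int, symmetric]) simp
    then show ?thesis
      using that by (simp add: interval_integral_Ioc algebra_simps)
  qed
  have "((\<lambda>r. LBINT s=t0..r. h s) has_vector_derivative h t) (at t within {t0..t + 1})"
    by (rule interval_integral_FTC2) (auto simp: t0_def intro: h)
  from has_vector_derivative_add[OF has_vector_derivative_const this, of "c t0"]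
  have "((\<lambda>r. c t0 + (LBINT s=t0..r. h s)) has_vector_derivative h t)
      (at t within {t0..t + 1})"
    by simp
  then have "(c has_vector_derivative h t) (at t within {t0..t + 1})"
  proof (rule has_vector_derivative_transform[rotated 2])
    show "c r = c t0 + (LBINT s=t0..r. h s)" if "r \<in> {t0..t + 1}" for r
      using that by (intro c_eq) simp
  qed (simp add: t0_def)
  then have "(c has_vector_derivative h t) (at t)"
    by (subst (asm) at_within_interior) (auto simp: t0_def)
  then show ?thesis
    unfolding green using U_mult_derivative[of c "h t" t]
    by (simp add: h_def matrix_inv_cancel_vec U_invertible)
qed

text \<open>
  For fixed \<open>s\<close> the kernel is locally constant in \<open>t\<close> off \<open>t = s\<close>, up to the continuous factor
  \<open>U t\<close>.
\<close>

lemma green_kernel_tendsto: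
  assumes t: "t \<longlonglongrightarrow> t'" and w: "w \<longlonglongrightarrow> w'" and s: "s \<noteq> t'"
  shows "(\<lambda>n. green_kernel (t n) s (w n)) \<longlonglongrightarrow> green_kernel t' s w'"
proof -
  note mv = bounded_bilinear.tendsto[OF bounded_bilinear_matrix_vector_mult]
  have "eventually (\<lambda>n. (if t n < s then matrix_inv (U s) *v w n else 0) =
      (if t' < s then matrix_inv (U s) *v w n else 0)) sequentially"
  proof (cases "t' < s")
    case True
    then show ?thesis
      using order_tendstoD(2)[OF t True] by (auto elim!: eventually_mono)
  next
    case False
    then have "t' > s" using s by simp
    then show ?thesis
      using order_tendstoD(1)[OF t \<open>t' > s\<close>] by (auto elim!: eventually_mono)
  qed
  moreover have "(\<lambda>n. if t' < s then matrix_inv (U s) *v w n else 0) \<longlonglongrightarrow>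
      (if t' < s then matrix_inv (U s) *v w' else 0)"
    by (auto intro!: mv w tendsto_const)
  ultimately have "(\<lambda>n. if t n < s then matrix_inv (U s) *v w n else 0) \<longlonglongrightarrow>
      (if t' < s then matrix_inv (U s) *v w' else 0)"
    by (subst tendsto_cong)
  moreover have "(\<lambda>n. U (t n)) \<longlonglongrightarrow> U t'"
    using continuous_on_tendsto_compose[OF continuous_on_U[of UNIV] t] by simp
  ultimately show ?thesis
    unfolding green_kernel_def green_coordinates_def
    by (intro mv tendsto_diff tendsto_const w)
qed

text \<open>
  Joint continuity in the time and a parameter of the forcing, by dominated convergence. The
  kernels at times \<open>t\<close> within distance \<open>B\<close> of \<open>t'\<close> have a common integrable bound, since moving
  the centre of \<open>exp (- \<alpha> * \<bar>t - s\<bar>)\<close> by at most \<open>B\<close> costs at most a factor \<open>exp (\<alpha> * B)\<close>.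
\<close>

lemma continuous_on_green:
  fixes g :: "'p::metric_space \<Rightarrow> real \<Rightarrow> real ^ 'n"
  assumes g: "continuous_on UNIV (\<lambda>(p, s). g p s)" and bound: "\<And>p s. N (g p s) \<le> m"
  shows "continuous_on UNIV (\<lambda>(p, t). green (g p) t)"
proof (rule continuous_on_sequentiallyI)
  fix x :: "nat \<Rightarrow> 'p \<times> real" and x' assume x: "x \<longlonglongrightarrow> x'"
  obtain c where c: "c > 0" "\<And>x :: real ^ 'n. norm x \<le> c * N x"
    using norm_le_is_norm[OF norm_N] by blast
  have p: "(\<lambda>n. fst (x n)) \<longlonglongrightarrow> fst x'" and t: "(\<lambda>n. snd (x n)) \<longlonglongrightarrow> snd x'"
    using x by (auto intro: tendsto_intros)
  have m: "m \<ge> 0"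
    using bound is_norm_nonneg[OF norm_N] order_trans by blast
  have gp: "continuous_on UNIV (g p)" for p
    using continuous_on_compose2[OF g continuous_on_Pair[OF continuous_on_const continuous_on_id]]
    by simp
  have gs: "(\<lambda>n. g (fst (x n)) s) \<longlonglongrightarrow> g (fst x') s" for s
    using continuous_on_tendsto_compose[OF g tendsto_Pair[OF p tendsto_const[of s]]] by simp
  obtain B where B: "\<And>n. \<bar>snd (x n) - snd x'\<bar> \<le> B"
    using LIM_zero[OF t, THEN convergentI, THEN convergent_imp_Bseq]
    by (auto simp: Bseq_def)
  let ?w = "\<lambda>s. c * (\<beta> * (exp (\<alpha> * B) * exp (- \<alpha> * \<bar>snd x' - s\<bar>)) * m)"
  have "(\<lambda>n. \<integral>s. green_kernel (snd (x n)) s (g (fst (x n)) s) \<partial>lborel) \<longlonglongrightarrow>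
      (\<integral>s. green_kernel (snd x') s (g (fst x') s) \<partial>lborel)"
  proof (rule integral_dominated_convergence[where w = ?w])
    show "integrable lborel ?w"
      using has_bochner_integral_exp_abs[OF \<alpha>_pos, of "snd x'"] by (auto dest: integrable.intros)
    show "AE s in lborel. (\<lambda>n. green_kernel (snd (x n)) s (g (fst (x n)) s)) \<longlonglongrightarrow>
        green_kernel (snd x') s (g (fst x') s)"
      using AE_lborel_singleton[of "snd x'"]
      by eventually_elim (rule green_kernel_tendsto[OF t gs])
    show "AE s in lborel. norm (green_kernel (snd (x n)) s (g (fst (x n)) s)) \<le> ?w s" for n
    proof (rule AE_I2)
      fix s
      have "\<alpha> * \<bar>snd x' - s\<bar> \<le> \<alpha> * (B + \<bar>snd (x n) - s\<bar>)"
        using B[of n] \<alpha>_pos by (intro mult_left_mono) auto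
      then have "exp (- \<alpha> * \<bar>snd (x n) - s\<bar>) \<le> exp (\<alpha> * B) * exp (- \<alpha> * \<bar>snd x' - s\<bar>)"
        by (simp add: exp_add[symmetric] algebra_simps)
      then have "N (green_kernel (snd (x n)) s (g (fst (x n)) s)) \<le>
          \<beta> * (exp (\<alpha> * B) * exp (- \<alpha> * \<bar>snd x' - s\<bar>)) * m"
        using \<beta>_ge_1 m
        by (intro order_trans[OF green_kernel_bound] mult_mono bound is_norm_nonneg[OF norm_N]) auto
      then show "norm (green_kernel (snd (x n)) s (g (fst (x n)) s)) \<le> ?w s"
        using c by (intro order_trans[OF c(2)] mult_left_mono) auto
    qed
  qed (intro measurable_green_kernel gp)+
  then show "(\<lambda>n. case x n of (p, t) \<Rightarrow> green (g p) t) \<longlonglongrightarrow> (case x' of (p, t) \<Rightarrow> green (g p) t)"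
    by (simp add: green_def case_prod_beta)
qed

end

section \<open>The conjugacy\<close>

locale perturbed_trichotomy = trichotomy N A U P Q \<alpha> \<beta>
  for N :: "real ^ 'n \<Rightarrow> real" and A U P Q \<alpha> \<beta> +
  fixes f :: "real \<Rightarrow> real ^ 'n \<Rightarrow> real ^ 'n" and \<mu> \<gamma> :: real
  assumes f_continuous: "continuous_on UNIV (\<lambda>(t, x). f t x)"
    and \<gamma>_nonneg: "\<gamma> \<ge> 0"
    and f_bound: "N (f t x) \<le> \<mu>"
    and f_lipschitz: "N (f t x - f t y) \<le> \<gamma> * N (x - y)"
    and small: "2 * \<beta> / \<alpha> * \<gamma> < 1"
begin

lemma continuous_on_f_compose:
  assumes "continuous_on S t" "continuous_on S x"
  shows "continuous_on S (\<lambda>p. f (t p) (x p))"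
  using continuous_on_compose2[OF f_continuous continuous_on_Pair[OF assms]] by simp

text \<open>
  The solution \<open>\<lambda>t. U t *v v\<close> of the linear equation is shadowed by the solution
  \<open>\<lambda>t. U t *v v + W v t\<close> of the perturbed one. The correction is a fixed point in the space of
  bounded continuous functions of the pair \<open>(v, t)\<close>; treating \<open>v\<close> and \<open>t\<close> together makes
  continuous dependence on \<open>v\<close> part of the construction, although \<open>U t *v v\<close> may be unbounded in \<open>t\<close>
  and linear solutions for nearby \<open>v\<close> need not be uniformly close.
\<close>

lemma bounded_correction_exists:
  "\<exists>W. continuous_on UNIV (\<lambda>(v, t). W v t) \<and>
     (\<forall>v t. W v t = green (\<lambda>s. f s (U s *v v + W v s)) t)"
proof -
  define S where "S = (\<lambda>\<phi> (v, t). green (\<lambda>s. f s (U s *v v + apply_bcontfun \<phi> (v, s))) t)"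
  define T where "T = (\<lambda>\<phi> :: ((real ^ 'n) \<times> real) \<Rightarrow>\<^sub>C (real ^ 'n). Bcontfun (S \<phi>))"
  obtain c where c: "c > 0" "\<And>x :: real ^ 'n. norm x \<le> c * N x"
    using norm_le_is_norm[OF norm_N] by blast
  obtain C where C: "C > 0" "\<And>x :: real ^ 'n. N x \<le> C * norm x"
    using is_norm_le_norm[OF norm_N] by blast
  define q where "q = 2 * \<beta> / \<alpha> * \<gamma>"
  have q: "0 \<le> q" "q < 1"
    using small \<alpha>_pos \<beta>_ge_1 \<gamma>_nonneg by (auto simp: q_def)
  have g: "continuous_on UNIV (\<lambda>(v, s). f s (U s *v v + apply_bcontfun \<phi> (v, s)))" for \<phi>
    unfolding case_prod_beta
    by (intro continuous_on_f_compose continuous_intros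
        continuous_on_compose2[OF continuous_on_U[of UNIV]]) auto
  have gv: "continuous_on UNIV (\<lambda>s. f s (U s *v v + apply_bcontfun \<phi> (v, s)))" for \<phi> v
    using continuous_on_compose2[OF g continuous_on_Pair[OF continuous_on_const continuous_on_id]]
    by simp
  have "S \<phi> \<in> bcontfun" for \<phi>
  proof -
    have "norm (S \<phi> p) \<le> c * (2 * \<beta> / \<alpha> * \<mu>)" for p
      unfolding S_def case_prod_beta using c(1)
      by (intro order_trans[OF c(2)] mult_left_mono green_bound gv f_bound) auto
    then show ?thesis
      unfolding bcontfun_def S_def
      using continuous_on_green[OF g f_bound] by (auto intro!: boundedI simp: S_def)
  qed
  then have T: "apply_bcontfun (T \<phi>) (v, t) =
      green (\<lambda>s. f s (U s *v v + apply_bcontfun \<phi> (v, s))) t" for \<phi> v t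
    by (simp add: T_def Bcontfun_inverse S_def)
  \<comment> \<open>The contraction factor \<open>q\<close> is only available pointwise for \<open>N\<close>, whereas distances between
    bounded functions use the Euclidean norm; the equivalence constants of the two norms are paid
    once, after iterating.\<close>
  have contract: "N (T \<phi> p - T \<psi> p) \<le> q * d" if "\<And>p. N (\<phi> p - \<psi> p) \<le> d"
    for \<phi> \<psi> :: "((real ^ 'n) \<times> real) \<Rightarrow>\<^sub>C (real ^ 'n)" and d p
  proof (cases p)
    case (Pair v t)
    have "N (f s (U s *v v + \<phi> (v, s)) - f s (U s *v v + \<psi> (v, s))) \<le> \<gamma> * d" for s
      using that[of "(v, s)"] \<gamma>_nonneg
      by (intro order_trans[OF f_lipschitz] mult_left_mono) auto
    then show ?thesis
      unfolding Pair T green_diff[OF gv f_bound gv f_bound] q_def mult.assoc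
      by (intro order_trans[OF green_bound] continuous_intros gv) (auto simp: mult.assoc)
  qed
  have iterate: "N ((T ^^ k) \<phi> p - (T ^^ k) \<psi> p) \<le> q ^ k * d"
    if "\<And>p. N (\<phi> p - \<psi> p) \<le> d" for \<phi> \<psi> :: "((real ^ 'n) \<times> real) \<Rightarrow>\<^sub>C (real ^ 'n)" and d p k
    using that
  proof (induction k arbitrary: p)
    case (Suc k)
    then show ?case
      using contract[of "(T ^^ k) \<phi>" "(T ^^ k) \<psi>" "q ^ k * d" p] by (simp add: mult.assoc)
  qed simp
  have "\<exists>\<phi>. T \<phi> = \<phi>"
  proof (rule banach_fix_iterate[OF q])
    fix k \<phi> \<psi>
    show "dist ((T ^^ k) \<phi>) ((T ^^ k) \<psi>) \<le> (c * C) * q ^ k * dist \<phi> \<psi>"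
    proof (rule dist_bound)
      fix p
      have "N (\<phi> p - \<psi> p) \<le> C * dist \<phi> \<psi>" for p
        using C dist_bounded[of \<phi> p \<psi>]
        by (intro order_trans[OF C(2)] mult_left_mono) (auto simp: dist_norm)
      then have "N ((T ^^ k) \<phi> p - (T ^^ k) \<psi> p) \<le> q ^ k * (C * dist \<phi> \<psi>)"
        by (rule iterate)
      then have "c * N ((T ^^ k) \<phi> p - (T ^^ k) \<psi> p) \<le> c * (q ^ k * (C * dist \<phi> \<psi>))"
        using c by simp
      then show "dist ((T ^^ k) \<phi> p) ((T ^^ k) \<psi> p) \<le> (c * C) * q ^ k * dist \<phi> \<psi>"
        using c(2)[of "(T ^^ k) \<phi> p - (T ^^ k) \<psi> p"] by (simp add: dist_norm mult_ac)
    qed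
  qed
  then obtain \<phi> where "T \<phi> = \<phi>" ..
  then have fixed: "apply_bcontfun \<phi> (v, t) =
      green (\<lambda>s. f s (U s *v v + apply_bcontfun \<phi> (v, s))) t" for v t
    using T[of \<phi> v t] by (simp only:)
  show ?thesis
  proof (intro exI[of _ "\<lambda>v t. apply_bcontfun \<phi> (v, t)"] conjI allI)
    show "continuous_on UNIV (\<lambda>(v, t). apply_bcontfun \<phi> (v, t))"
      by (simp add: case_prod_beta)
  qed (rule fixed)
qed

end

theorem theorem3p1:
  fixes N :: "real ^ 'n \<Rightarrow> real"
    and A U :: "real \<Rightarrow> real ^ 'n ^ 'n"
    and P Q :: "real ^ 'n ^ 'n"
    and f :: "real \<Rightarrow> real ^ 'n \<Rightarrow> real ^ 'n"
    and \<alpha> \<beta> \<mu> \<gamma> :: real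
  assumes "is_norm N"
    and "continuous_on UNIV A"
    and "\<exists>M. \<forall>t. matrix_norm N (A t) \<le> M"
    and "continuous_on UNIV (\<lambda>(t, x). f t x)"
    and "fundamental_matrix A U"
    and "exponential_trichotomy N U P Q \<beta> \<alpha>"
    and "\<mu> \<ge> 0" and "\<gamma> \<ge> 0"
    and "\<And>t x. N (f t x) \<le> \<mu>"
    and "\<And>t x\<^sub>1 x\<^sub>2. N (f t x\<^sub>1 - f t x\<^sub>2) \<le> \<gamma> * N (x\<^sub>1 - x\<^sub>2)"
    and "3 * \<beta> * \<gamma> * inverse \<alpha> < 1"
  shows "topologically_conjugated N (\<lambda>t x. A t *v x + f t x) (\<lambda>t x. A t *v x)"
proof -
  interpret trichotomy N A U P Q \<alpha> \<beta>
    by unfold_locales (rule assms)+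
  \<comment> \<open>The Green kernel has mass \<open>2 * \<beta> / \<alpha>\<close>, so the smallness hypothesis makes the operator a
    contraction.\<close>
  have "2 * (\<beta> / \<alpha> * \<gamma>) \<le> 3 * (\<beta> / \<alpha> * \<gamma>)"
    using \<alpha>_pos \<beta>_ge_1 \<open>\<gamma> \<ge> 0\<close> by (intro mult_right_mono) auto
  then have "2 * \<beta> / \<alpha> * \<gamma> < 1"
    using assms(11) by (simp add: field_simps)
  then interpret perturbed_trichotomy N A U P Q \<alpha> \<beta> f \<mu> \<gamma>
    by unfold_locales (use assms in auto)
  let ?F = "\<lambda>t x. A t *v x + f t x" and ?G = "\<lambda>t x. A t *v x"
  obtain c where c: "c > 0" "\<And>x :: real ^ 'n. norm x \<le> c * N x"
    using norm_le_is_norm[OF norm_N] by blast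
  obtain C where C: "C > 0" "\<And>x :: real ^ 'n. N x \<le> C * norm x"
    using is_norm_le_norm[OF norm_N] by blast
  obtain M where M: "\<And>t. matrix_norm N (A t) \<le> M"
    using assms(3) by blast
  have N_pos: "N x \<ge> 0" for x by (rule is_norm_nonneg[OF norm_N])
  have N_to_norm: "norm w \<le> c * (\<bar>K\<bar> * C) * norm x" if "N w \<le> K * N x"
    for w x :: "real ^ 'n" and K
  proof -
    have "N w \<le> \<bar>K\<bar> * (C * norm x)"
      using that mult_mono[OF abs_ge_self[of K] C(2)[of x]] N_pos by simp
    then have "c * N w \<le> c * (\<bar>K\<bar> * (C * norm x))"
      using c by simp
    then show ?thesis
      using c(2)[of w] by (simp add: mult_ac)
  qed
  have lipG: "N (A t *v x - A t *v y) \<le> M * N (x - y)" for t x y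
    using matrix_norm_bound[OF norm_N, of "A t" "x - y"] mult_right_mono[OF M[of t] N_pos[of "x - y"]]
    by (simp add: matrix_vector_mult_diff_distrib)
  have lipF: "N (?F t x - ?F t y) \<le> (M + \<gamma>) * N (x - y)" for t x y
    using is_norm_triangle[OF norm_N, of "A t *v x - A t *v y" "f t x - f t y"]
      lipG[of t x y] f_lipschitz[of t x y]
    by (simp add: algebra_simps)
  have uniqueF: "x = y" if "ode_solution ?F x" "ode_solution ?F y" "x t = y t" for x y t
    by (rule ode_solution_unique[OF N_to_norm[OF lipF] that])
  have uniqueG: "x = y" if "ode_solution ?G x" "ode_solution ?G y" "x t = y t" for x y t
    by (rule ode_solution_unique[OF N_to_norm[OF lipG] that])

  obtain W where W: "continuous_on UNIV (\<lambda>(v, t). W v t)"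
    "\<And>v t. W v t = green (\<lambda>s. f s (U s *v v + W v s)) t"
    using bounded_correction_exists by blast
  \<comment> \<open>\<open>X v\<close> is the solution of the perturbed equation that shadows the linear solution with
    coordinates \<open>v\<close>; \<open>L t\<close> moves the latter to the former at time \<open>t\<close>.\<close>
  define X where "X = (\<lambda>v t. U t *v v + W v t)"
  define L where "L = (\<lambda>t y. X (matrix_inv (U t) *v y) t)"
  have WX: "W v = green (\<lambda>s. f s (X v s))" for v
    unfolding X_def by (rule ext) (rule W(2))
  have Wcont: "continuous_on S (\<lambda>p. W (v p) (t p))" if "continuous_on S v" "continuous_on S t"
    for S :: "'s::topological_space set" and v t
    using continuous_on_compose2[OF W(1) continuous_on_Pair[OF that]] by simp
  have gcont: "continuous_on UNIV (\<lambda>s. f s (X v s))" for v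
    unfolding X_def
    by (intro continuous_on_f_compose continuous_intros Wcont continuous_on_U)
  have W_bound: "N (W v t) \<le> 2 * \<beta> / \<alpha> * \<mu>" for v t
    unfolding WX by (rule green_bound[OF gcont f_bound])
  have solG: "ode_solution ?G (\<lambda>t. U t *v v)" for v
    using U_mult_derivative[OF has_vector_derivative_const, of v] by (simp add: ode_solution_def)
  have solF: "ode_solution ?F (X v)" for v
    unfolding ode_solution_def X_def
    using has_vector_derivative_add[OF solG[unfolded ode_solution_def, rule_format]
        green_derivative[OF gcont f_bound, folded WX]]
    by (simp add: X_def algebra_simps matrix_vector_right_distrib)
  have L_U: "L t (U t *v v) = X v t" for t v
    by (simp add: L_def matrix_inv_cancel_vec U_invertible)
  have L_id: "L t y - y = W (matrix_inv (U t) *v y) t" for t y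
    by (simp add: L_def X_def matrix_inv_cancel_vec U_invertible)
  have L_bound: "N (L t y - y) \<le> 2 * \<beta> / \<alpha> * \<mu>" for t y
    unfolding L_id by (rule W_bound)
  have Lcont: "continuous_on UNIV (L t)" for t
    unfolding L_def X_def
    by (intro continuous_intros Wcont)
  \<comment> \<open>If two shadowing solutions meet, they coincide; then so do their forcing terms, hence their
    corrections, and hence the linear solutions they shadow.\<close>
  have Linj: "inj (L t)" for t
  proof (rule injI)
    fix y z assume eq: "L t y = L t z"
    define v w where "v = matrix_inv (U t) *v y" and "w = matrix_inv (U t) *v z"
    have "X v = X w"
      using eq by (intro uniqueF solF) (auto simp: L_def v_def w_def)
    then have "W v = W w"
      by (simp add: WX)
    moreover have "U t *v u = X u t - W u t" for u
      by (simp add: X_def)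
    ultimately have "U t *v v = U t *v w"
      by (simp only: \<open>X v = X w\<close>)
    then show "y = z"
      by (simp add: v_def w_def matrix_inv_cancel_vec U_invertible)
  qed
  have Lsurj: "surj (L t)" for t
    using c by (intro bounded_displacement_surj[OF Lcont, of t "c * (2 * \<beta> / \<alpha> * \<mu>)"]
        order_trans[OF c(2)] mult_left_mono L_bound) auto
  have "\<exists>h. homeomorphism UNIV UNIV (L t) h" for t
    using invariance_of_domain_homeomorphism[OF open_UNIV Lcont order_refl Linj, of t] Lsurj
    by metis
  then obtain H where H: "\<And>t. homeomorphism UNIV UNIV (L t) (H t)"
    by metis
  have HL: "H t (L t y) = y" and LH: "L t (H t x) = x" for t x y
    using H[of t] by (auto simp: homeomorphism_def)
  \<comment> \<open>Surjectivity of \<open>L 0\<close> and uniqueness: every solution of the perturbed equation shadows a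
    linear one.\<close>
  have X_reaches: "\<exists>v. x = X v" if "ode_solution ?F x" for x
  proof -
    have "x 0 = X (matrix_inv (U 0) *v H 0 (x 0)) 0"
      using LH[of 0 "x 0"] by (simp add: L_def)
    then show ?thesis
      using uniqueF[OF that solF] by blast
  qed
  have U_reaches: "\<exists>v. y = (\<lambda>t. U t *v v)" if "ode_solution ?G y" for y
    using uniqueG[OF that solG, of 0 "matrix_inv (U 0) *v y 0"]
    by (auto simp: matrix_inv_cancel_vec U_invertible)
  have "equivalent_function N ?F ?G H"
    unfolding equivalent_function_def
  proof (intro exI[of _ L] conjI allI impI)
    show "homeomorphism UNIV UNIV (H t) (L t)" for t
      using H by (rule homeomorphism_symD)
    show "\<exists>B. \<forall>t x. N (L t x - x) \<le> B"
      using L_bound by blast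
    have "N (H t x - x) \<le> 2 * \<beta> / \<alpha> * \<mu>" for t x
      using L_bound[of t "H t x"] is_norm_minus[OF norm_N, of "H t x - x"] by (simp add: LH)
    then show "\<exists>B. \<forall>t x. N (H t x - x) \<le> B"
      by blast
    show "ode_solution ?G (\<lambda>t. H t (x t))" if x: "ode_solution ?F x" for x
    proof -
      obtain v where "x = X v"
        using X_reaches[OF x] by blast
      then have "(\<lambda>t. H t (x t)) = (\<lambda>t. U t *v v)"
        by (simp add: HL flip: L_U)
      then show ?thesis
        using solG by simp
    qed
    show "ode_solution ?F (\<lambda>t. L t (y t))" if y: "ode_solution ?G y" for y
    proof -
      obtain v where "y = (\<lambda>t. U t *v v)"
        using U_reaches[OF y] by blast
      then have "(\<lambda>t. L t (y t)) = X v"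
        by (simp add: L_U)
      then show ?thesis
        using solF by simp
    qed
  qed
  then show ?thesis
    unfolding topologically_conjugated_def by blast
qed

end
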